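(* For integers $n\ge 1$ let $L_1(n)=2^{2n}+2^n+1$. Let $k\ge 0$ and $n\ge 1$ be integers with $n\not\equiv 0\pmod 3$. Then $L_1(7^k n)\equiv 0\pmod{7^{k+1}}$. *)

theory Defs
  imports "HOL-Number_Theory.Number_Theory"
begin

definition L1 :: "nat \<Rightarrow> int" where
  "L1 n = 2 ^ (2 * n) + 2 ^ n + 1"

end

theory Submission
  imports Defs
begin

text \<open>With \<open>x = 2 ^ m\<close> for \<open>m = 7 ^ k * n\<close>, one has \<open>(x - 1) * L1 m = x ^ 3 - 1 = 8 ^ m - 1\<close>.
  Since \<open>8 \<equiv> 1\<close> modulo 7, raising to the power \<open>7 ^ k\<close> lifts this to a congruence
  modulo \<open>7 ^ (k + 1)\<close>, while \<open>x - 1\<close> is prime to 7 because 2 has order 3 modulo 7.\<close>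

text \<open>Each further \<open>p\<close>-th power gains one factor \<open>p\<close>:
  \<open>b ^ p - 1\<close> is \<open>b - 1\<close> times a geometric sum in \<open>b\<close>, and
  that sum is divisible by \<open>p\<close> once \<open>b\<close> is 1 modulo
  \<open>p\<close>.\<close>

lemma power_power_cong_1:
  fixes a :: int and p k :: nat
  assumes "[a = 1] (mod int p)"
  shows "[a ^ (p ^ k) = 1] (mod int p ^ (k + 1))"
proof (induction k)
  case 0
  then show ?case using assms by simp
next
  case (Suc k)
  define b where "b = a ^ (p ^ k)"
  have "[b = 1] (mod int p)"
    using cong_pow[OF assms, of "p ^ k"] by (simp add: b_def)
  \<comment> \<open>The sum has \<open>p\<close> terms, each 1 modulo \<open>p\<close>, so it is
    congruent to \<open>p\<close>, that is, to 0.\<close>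
  then have "[(\<Sum>i<p. b ^ i) = (\<Sum>i<p. 1 ^ i)] (mod int p)"
    by (intro cong_sum cong_pow)
  then have "int p dvd (\<Sum>i<p. b ^ i)"
    by (simp add: cong_dvd_iff)
  moreover have "int p ^ (k + 1) dvd b - 1"
    using Suc by (simp add: b_def cong_iff_dvd_diff)
  ultimately have "int p ^ (k + 1) * int p dvd (b - 1) * (\<Sum>i<p. b ^ i)"
    by (rule mult_dvd_mono[rotated])
  then have "int p ^ (Suc k + 1) dvd b ^ p - 1"
    by (simp add: power_diff_1_eq mult.commute)
  then show ?case
    by (simp add: b_def cong_iff_dvd_diff mult.commute flip: power_mult)
qed

text \<open>As \<open>2 ^ 3\<close> is 1 modulo 7, only \<open>m mod 3\<close> matters: the residue
  of \<open>2 ^ m\<close> is 2 or 4, never 1, and 7 is prime.\<close>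

lemma two_power_minus_1_coprime_7:
  fixes m :: nat
  assumes "\<not> 3 dvd m"
  shows "coprime (2 ^ m - 1 :: int) 7"
proof -
  have "[(2::int) ^ m = 2 ^ (m mod 3)] (mod 7)"
  proof -
    have "(2::int) ^ m = 8 ^ (m div 3) * 2 ^ (m mod 3)"
      using power_add[of "2::int" "3 * (m div 3)" "m mod 3"] by (simp add: power_mult)
    moreover have "[(8::int) ^ (m div 3) = 1 ^ (m div 3)] (mod 7)"
      by (intro cong_pow) (simp add: cong_def)
    ultimately show ?thesis
      using cong_scalar_right by fastforce
  qed
  moreover have "m mod 3 = 1 \<or> m mod 3 = 2"
    using assms by presburger
  ultimately have "\<not> [(2::int) ^ m = 1] (mod 7)"
    by (auto simp: cong_def)
  then have "\<not> 7 dvd (2 ^ m - 1 :: int)"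
    by (simp add: cong_iff_dvd_diff)
  moreover have "prime (7::int)"
    by simp
  ultimately show ?thesis
    using prime_imp_coprime coprime_commute by blast
qed

theorem theorem3:
  fixes k n :: nat
  assumes "n \<ge> 1" and "\<not> [n = 0] (mod 3)"
  shows "[L1 (7 ^ k * n) = 0] (mod 7 ^ (k + 1))"
proof -
  define m where "m = 7 ^ k * n"
  \<comment> \<open>The factor \<open>7 ^ k\<close> brings in no 3, so \<open>m\<close> inherits
    from \<open>n\<close> that 3 does not divide it.\<close>
  have "coprime (3::nat) (7 ^ k)"
    by (intro coprime_power_right_iff[THEN iffD2] disjI1) (simp add: coprime_iff_gcd_eq_1 gcd_non_0_nat)
  then have "\<not> 3 dvd m"
    using assms(2) by (simp add: m_def cong_0_iff coprime_dvd_mult_right_iff)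
  then have coprime: "coprime (7 ^ (k + 1)) (2 ^ m - 1 :: int)"
    using two_power_minus_1_coprime_7 coprime_commute coprime_power_right_iff by blast
  have "[(8::int) ^ 7 ^ k = 1] (mod 7 ^ (k + 1))"
    using power_power_cong_1[of 8 7 k] by (simp add: cong_def)
  then have "[(8::int) ^ m = 1] (mod 7 ^ (k + 1))"
    using cong_pow[of _ 1 _ n] by (fastforce simp: m_def power_mult)
  moreover have "(2 ^ m - 1) * L1 m = 8 ^ m - 1"
  proof -
    have "(8::int) ^ m = (2 ^ m) ^ 3"
      by (simp flip: power_mult add: mult.commute[of m] power_mult)
    moreover have "(2::int) ^ (2 * m) = (2 ^ m) ^ 2"
      by (simp add: power_mult[symmetric] mult.commute)
    ultimately show ?thesis
      unfolding L1_def by (simp add: power2_eq_square power3_eq_cube algebra_simps)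
  qed
  ultimately have "7 ^ (k + 1) dvd (2 ^ m - 1) * L1 m"
    by (simp add: cong_iff_dvd_diff)
  \<comment> \<open>The factor \<open>2 ^ m - 1\<close> is coprime to the modulus and
    cancels.\<close>
  then have "7 ^ (k + 1) dvd L1 m"
    using coprime coprime_dvd_mult_right_iff by blast
  then show ?thesis
    by (simp add: m_def cong_0_iff)
qed

end
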